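(* For all integers $n\geq 0$, $$pond(27n+17) \equiv pond(3n+2) \pmod{3}.$$
   Context: A POND partition is an integer partition in which the odd parts are not allowed to be distinct, i.e., no odd part appears with multiplicity exactly one (every odd part that occurs appears at least twice), while the even parts are unrestricted. For an integer $n\geq 0$, $pond(n)$ denotes the number of POND partitions of weight $n$, i.e., POND partitions whose parts sum to $n$ (the empty partition is counted, so $pond(0)=1$). *)

theory Defs
  imports "HOL-Library.Multiset" "HOL-Number_Theory.Cong"
begin

definition is_partition :: "nat multiset \<Rightarrow> nat \<Rightarrow> bool" where
  "is_partition M n \<longleftrightarrow> (\<forall>k\<in>#M. k > 0) \<and> sum_mset M = n"

definition is_pond_partition :: "nat multiset \<Rightarrow> nat \<Rightarrow> bool" where
  "is_pond_partition M n \<longleftrightarrow> is_partition M n \<and> (\<forall>k\<in>#M. odd k \<longrightarrow> count M k \<noteq> 1)"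

definition pond :: "nat \<Rightarrow> nat" where
  "pond n = card {M. is_pond_partition M n}"

(* Hence card in pond_def is a genuine count, not the value 0 it takes on infinite sets. *)
lemma finite_pond_partitions: "finite {M. is_pond_partition M n}"
proof (rule finite_subset)
  have size: "size M \<le> sum_mset M" if "\<forall>k\<in>#M. k > 0" for M :: "nat multiset"
    using that by (induction M) auto
  have part: "k \<le> sum_mset M" if "k \<in># M" for k :: nat and M
    using sum_mset.remove[OF that] by simp
  show "{M. is_pond_partition M n} \<subseteq> mset ` {xs. set xs \<subseteq> {..n} \<and> length xs \<le> n}"
  proof
    fix M assume "M \<in> {M. is_pond_partition M n}"
    then have M: "\<forall>k\<in>#M. k > 0" "sum_mset M = n"
      by (auto simp: is_pond_partition_def is_partition_def)
    obtain xs where xs: "mset xs = M" using ex_mset by blast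
    have "length xs \<le> n" using size[OF M(1)] M(2) xs by (metis size_mset)
    moreover have "set xs \<subseteq> {..n}" using part M(2) xs by (metis atMost_iff set_mset_mset subsetI)
    ultimately show "M \<in> mset ` {xs. set xs \<subseteq> {..n} \<and> length xs \<le> n}" using xs by blast
  qed
qed (intro finite_imageI finite_lists_length_le finite_atMost)

end

(*
Let P be the generating function of pond and let psi(q) be the sum of q^(k(k+1)/2), k >= 0.
For odd m, the factor 1/(1-q^m) - q^m of P equals (1+q^(3m))/(1-q^(2m)), which modulo 3 is
(1+q^m)^2/(1-q^m). With Gauss's psi(q) = prod (1-q^(2k))/(1-q^(2k-1)) this gives
P(q) psi(-q)^2 = psi(q), hence P(q) psi(-q^3) = psi(q) psi(-q) modulo 3. Triangular numbers are
never 2 modulo 3, and psi(q) contributes q psi(q^9) to the exponents that are 1 modulo 3. Hence,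
modulo 3, the pond(3n+2) have generating function A(q) = - psi(q^3) psi(-q)^2. Extracting from A
the exponents 3n+2 and then, from the result, the exponents 3n+1 gives back A.
*)
theory Submission
  imports Defs "HOL-Computational_Algebra.Formal_Power_Series" "HOL-Library.Nat_Bijection"
begin

unbundle fps_syntax

section \<open>Divisibility of integer power series and cubing modulo 3\<close>

lemma fps_X_power_dvd_iff: "fps_X ^ N dvd (f :: int fps) \<longleftrightarrow> (\<forall>k<N. f $ k = 0)"
proof
  assume "\<forall>k<N. f $ k = 0"
  then have "f = fps_X ^ N * fps_shift N f"
    by (intro fps_ext) (auto simp: fps_X_power_mult_nth)
  then show "fps_X ^ N dvd f" by (metis dvd_triv_left)
qed (auto simp: dvd_def fps_X_power_mult_nth)

lemma three_times_nth [simp]: "(3 * f) $ n = 3 * (f :: int fps) $ n"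
  by (simp add: numeral_fps_const)

lemma three_dvd_fps_iff: "3 dvd (f :: int fps) \<longleftrightarrow> (\<forall>k. 3 dvd f $ k)"
proof
  assume "\<forall>k. 3 dvd f $ k"
  then have "f = 3 * Abs_fps (\<lambda>k. f $ k div 3)"
    by (intro fps_ext) auto
  then show "3 dvd f" by (metis dvd_triv_left)
qed (auto simp: dvd_def)

lemma fps_dvd_mult_unit_cancel:
  assumes "d dvd h * (f :: int fps)" "h $ 0 = 1"
  shows "d dvd f"
proof -
  have "fps_left_inverse h 1 * h = 1" using assms(2) by (intro fps_left_inverse) simp
  then have "f = fps_left_inverse h 1 * (h * f)" by (simp flip: mult.assoc)
  with assms(1) show ?thesis by (metis dvd_mult)
qed

lemma fps_nth_compose_X_cubed:
  "(f oo fps_X ^ 3) $ n = (if 3 dvd n then (f :: int fps) $ (n div 3) else 0)"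
proof -
  have "(f oo fps_X ^ 3) $ n = (\<Sum>i=0..n. if n = 3 * i then f $ i else 0)"
    unfolding fps_compose_nth by (intro sum.cong) (auto simp flip: power_mult)
  also have "\<dots> = (if 3 dvd n then f $ (n div 3) else 0)"
  proof (cases "3 dvd n")
    case True
    then have "(\<Sum>i=0..n. if n = 3 * i then f $ i else 0) = (\<Sum>i=0..n. if i = n div 3 then f $ i else 0)"
      by (intro sum.cong) auto
    with True show ?thesis by simp
  next
    case False
    then show ?thesis by (auto intro!: sum.neutral)
  qed
  finally show ?thesis .
qed

lemma three_dvd_cube_diff: "3 dvd (c :: int) ^ 3 - c"
proof -
  have "c ^ 3 - c = (c - 1) * c * (c + 1)" by (simp add: algebra_simps power3_eq_cube)
  moreover have "3 dvd c \<or> 3 dvd c - 1 \<or> 3 dvd c + 1" by presburger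
  ultimately show ?thesis by auto
qed

text \<open>The Frobenius map modulo 3. Writing f = c + X g, the mixed terms of the cube are
  divisible by 3 and c^3 = c modulo 3, while X^3 g^3 reduces the claim for \<open>f\<close> at
  \<open>n\<close> to the claim for \<open>g\<close> at \<open>n - 3\<close>; hence the induction
  over arbitrary \<open>f\<close>.\<close>

lemma three_dvd_fps_cube_diff: "3 dvd (f :: int fps) ^ 3 - (f oo fps_X ^ 3)"
  unfolding three_dvd_fps_iff
proof
  fix n show "3 dvd (f ^ 3 - (f oo fps_X ^ 3)) $ n"
  proof (induction n arbitrary: f rule: less_induct)
    case (less n)
    define c where "c = f $ 0"
    define g where "g = fps_shift 1 f"
    have f: "f = fps_const c + fps_X * g"
      by (rule fps_ext) (auto simp: c_def g_def)
    define r where "r = fps_const c * fps_X * g * (fps_const c + fps_X * g)"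
    have "f ^ 3 = fps_const (c ^ 3) + fps_X ^ 3 * g ^ 3 + 3 * r"
      unfolding f r_def fps_const_power[symmetric] by algebra
    then have nth: "(f ^ 3) $ n = (if n = 0 then c ^ 3 else 0) + (if n < 3 then 0 else (g ^ 3) $ (n - 3)) + 3 * r $ n"
      by (simp add: fps_X_power_mult_nth)
    show ?case
    proof (cases "n < 3")
      case True
      then consider "n = 0" | "n = 1" | "n = 2" by linarith
      then show ?thesis
      proof cases
        case 1
        have "(f ^ 3 - (f oo fps_X ^ 3)) $ n = (c ^ 3 - c) + 3 * r $ n"
          using 1 nth by (simp add: fps_nth_compose_X_cubed c_def)
        then show ?thesis using three_dvd_cube_diff[of c] by simp
      qed (use nth in \<open>auto simp: fps_nth_compose_X_cubed\<close>)
    next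
      case False
      have "3 dvd (g ^ 3 - (g oo fps_X ^ 3)) $ (n - 3)" using False by (intro less.IH) auto
      moreover have "(f oo fps_X ^ 3) $ n = (g oo fps_X ^ 3) $ (n - 3)"
      proof -
        obtain k where k: "n = k + 3" using False by (metis add.commute le_Suc_ex not_less)
        show ?thesis by (auto simp: fps_nth_compose_X_cubed k g_def)
      qed
      then have "(f ^ 3 - (f oo fps_X ^ 3)) $ n = (g ^ 3 - (g oo fps_X ^ 3)) $ (n - 3) + 3 * r $ n"
        using nth False by simp
      ultimately show ?thesis by simp
    qed
  qed
qed

subsection \<open>Trisection\<close>

definition trisect :: "nat \<Rightarrow> int fps \<Rightarrow> int fps" where
  "trisect r f = Abs_fps (\<lambda>n. f $ (3 * n + r))"

lemma trisect_nth [simp]: "trisect r f $ n = f $ (3 * n + r)"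
  by (simp add: trisect_def)

lemma trisect_linear:
  "trisect r (f + g) = trisect r f + trisect r g"
  "trisect r (f - g) = trisect r f - trisect r g"
  "trisect r (- f) = - trisect r f"
  "trisect r (3 * f) = 3 * trisect r f"
  by (auto intro!: fps_ext)

text \<open>A series in X^3 shifts exponents by multiples of 3 only, so it passes through the
  selection of a residue class.\<close>

lemma trisect_mult_compose:
  assumes "r < 3"
  shows "trisect r (f * (g oo fps_X ^ 3)) = trisect r f * g"
proof (rule fps_ext)
  fix n
  have "trisect r (f * (g oo fps_X ^ 3)) $ n =
      (\<Sum>i=0..3*n+r. (g oo fps_X ^ 3) $ i * f $ (3 * n + r - i))"
    by (simp add: mult.commute[of f] fps_mult_nth)
  also have "\<dots> = (\<Sum>i\<in>(*) 3 ` {0..n}. (g oo fps_X ^ 3) $ i * f $ (3 * n + r - i))"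
  proof (rule sum.mono_neutral_right)
    have "i \<in> (*) 3 ` {0..n}" if "i \<le> 3 * n + r" "3 dvd i" for i
    proof
      show "i = 3 * (i div 3)" "i div 3 \<in> {0..n}" using that assms by auto
    qed
    then show "\<forall>i\<in>{0..3*n+r} - (*) 3 ` {0..n}. (g oo fps_X ^ 3) $ i * f $ (3 * n + r - i) = 0"
      by (auto simp: fps_nth_compose_X_cubed)
  qed auto
  also have "\<dots> = (\<Sum>i=0..n. g $ i * f $ (3 * n + r - 3 * i))"
    by (subst sum.reindex) (auto simp: inj_on_def fps_nth_compose_X_cubed)
  also have "\<dots> = (\<Sum>i=0..n. g $ i * trisect r f $ (n - i))"
  proof (intro sum.cong refl)
    fix i assume "i \<in> {0..n}"
    then have "3 * n + r - 3 * i = 3 * (n - i) + r" by auto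
    then show "g $ i * f $ (3 * n + r - 3 * i) = g $ i * trisect r f $ (n - i)" by simp
  qed
  also have "\<dots> = (trisect r f * g) $ n"
    by (simp add: mult.commute[of _ g] fps_mult_nth)
  finally show "trisect r (f * (g oo fps_X ^ 3)) $ n = (trisect r f * g) $ n" .
qed

text \<open>With no exponents congruent to 2 in either factor, the residue 2 arises in the product
  only as 1 + 1.\<close>

lemma trisect_2_mult:
  assumes "trisect 2 f = 0" "trisect 2 g = 0"
  shows "trisect 2 (f * g) = trisect 1 f * trisect 1 g"
proof -
  have split: "h = (trisect 0 h oo fps_X ^ 3) + fps_X * (trisect 1 h oo fps_X ^ 3)" if "trisect 2 h = 0" for h
  proof (rule fps_ext)
    fix n :: nat
    define k where "k = n div 3"
    have "h $ (3 * k + 2) = 0" using that by (metis trisect_nth fps_zero_nth)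
    moreover have "n = 3 * k \<or> n = 3 * k + 1 \<or> n = 3 * k + 2" unfolding k_def by presburger
    \<comment> \<open>The index \<open>3 * k - 1\<close> comes from the shift by
      \<open>fps_X\<close>; at \<open>k = 0\<close> truncated subtraction turns it into 0, hence the
      exception.\<close>
    moreover have "\<not> 3 dvd 3 * k + 1" "\<not> 3 dvd 3 * k + 2" "\<not> 3 dvd 3 * k - 1 \<or> k = 0" by presburger+
    ultimately show "h $ n = ((trisect 0 h oo fps_X ^ 3) + fps_X * (trisect 1 h oo fps_X ^ 3)) $ n"
      by (auto simp: fps_nth_compose_X_cubed)
  qed
  have c: "a * b oo fps_X ^ 3 = (a oo fps_X ^ 3) * (b oo fps_X ^ 3)" for a b :: "int fps"
    by (rule fps_compose_mult_distrib) simp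
  define f0 f1 g0 g1 where defs: "f0 = trisect 0 f" "f1 = trisect 1 f" "g0 = trisect 0 g" "g1 = trisect 1 g"
  have "f * g = ((f0 oo fps_X ^ 3) + fps_X * (f1 oo fps_X ^ 3)) * ((g0 oo fps_X ^ 3) + fps_X * (g1 oo fps_X ^ 3))"
    unfolding defs using split[OF assms(1)] split[OF assms(2)] by simp
  \<comment> \<open>The factor \<open>1\<close> is kept so that each summand has the shape that
    \<open>trisect_mult_compose\<close> expects.\<close>
  also have "\<dots> = 1 * (f0 * g0 oo fps_X ^ 3) + fps_X * (f0 * g1 + f1 * g0 oo fps_X ^ 3) + fps_X ^ 2 * (f1 * g1 oo fps_X ^ 3)"
    unfolding c fps_compose_add_distrib by algebra
  finally have "trisect 2 (f * g) = trisect 2 1 * (f0 * g0) + trisect 2 fps_X * (f0 * g1 + f1 * g0)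
      + trisect 2 (fps_X ^ 2) * (f1 * g1)"
    by (simp only: trisect_linear trisect_mult_compose numeral_less_iff semiring_norm)
  moreover have "trisect 2 1 = 0" "trisect 2 fps_X = 0" "trisect 2 (fps_X ^ 2) = 1"
    by (auto intro!: fps_ext)
  ultimately show ?thesis by (simp add: defs)
qed

subsection \<open>Gauss's triangular series\<close>

text \<open>This is psi(cq), so that \<open>c = 1\<close> and \<open>c = -1\<close> give psi(q) and
  psi(-q) uniformly.\<close>

definition psi :: "int \<Rightarrow> int fps" where
  "psi c = Abs_fps (\<lambda>k. if k \<in> range triangle then c ^ k else 0)"

lemma two_triangle: "2 * triangle n = n * (n + 1)"
  unfolding triangle_def by simp

lemma triangle_less: "m < n \<Longrightarrow> triangle m < triangle n"
  by (induction n) (auto simp: less_Suc_eq)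

lemma triangle_3: "triangle (3 * b) + 3 * b = 9 * triangle b"
proof (induction b)
  case (Suc b)
  have "triangle (3 * Suc b) = triangle (Suc (Suc (Suc (3 * b))))"
    by (rule arg_cong[where f = triangle]) simp
  with Suc show ?case by simp
qed simp

lemma triangle_3_plus_1: "triangle (3 * b + 1) = 9 * triangle b + 1"
  using triangle_3[of b] by simp

lemma triangle_3_plus_2: "triangle (3 * b + 2) = 3 * (3 * triangle b + b + 1)"
  using triangle_3[of b] by (simp add: numeral_2_eq_2)

lemma triangle_cases:
  obtains b where "triangle a + 3 * b = 9 * triangle b"
    | b where "triangle a = 9 * triangle b + 1"
    | b where "triangle a = 3 * (3 * triangle b + b + 1)"
proof -
  have "\<exists>b. a = 3 * b \<or> a = 3 * b + 1 \<or> a = 3 * b + 2" by presburger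
  then obtain b where "a = 3 * b \<or> a = 3 * b + 1 \<or> a = 3 * b + 2" ..
  then show thesis using triangle_3[of b] triangle_3_plus_1[of b] triangle_3_plus_2[of b] that[of b] by (elim disjE) (simp_all only:)
qed

text \<open>Of the triangular numbers with index 3b, 3b + 1 and 3b + 2, the first and the last are
  divisible by 3 and the middle one is 9 T(b) + 1, where T(b) is \<open>triangle b\<close>.\<close>

lemma range_triangle_3:
  "3 * n + 2 \<notin> range triangle"
  "3 * n + 1 \<in> range triangle \<longleftrightarrow> 3 dvd n \<and> n div 3 \<in> range triangle"
proof -
  show "3 * n + 2 \<notin> range triangle"
  proof
    assume "3 * n + 2 \<in> range triangle"
    then obtain a where a: "3 * n + 2 = triangle a" by blast
    show False by (rule triangle_cases[of a]; unfold a[symmetric]; presburger)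
  qed
  show "3 * n + 1 \<in> range triangle \<longleftrightarrow> 3 dvd n \<and> n div 3 \<in> range triangle"
  proof
    assume "3 * n + 1 \<in> range triangle"
    then obtain a where a: "3 * n + 1 = triangle a" by blast
    have "\<exists>b. n = 3 * triangle b"
    proof (rule triangle_cases[of a]; unfold a[symmetric])
      fix b assume "3 * n + 1 = 9 * triangle b + 1"
      then have "n = 3 * triangle b" by simp
      then show ?thesis ..
    qed presburger+
    then show "3 dvd n \<and> n div 3 \<in> range triangle" by auto
  next
    assume "3 dvd n \<and> n div 3 \<in> range triangle"
    then obtain b where "n = 3 * triangle b" by auto
    then have "3 * n + 1 = triangle (3 * b + 1)" using triangle_3_plus_1[of b] by simp
    then show "3 * n + 1 \<in> range triangle" by blast
  qed
qed

lemma psi_0 [simp]: "psi c $ 0 = 1"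
proof -
  have "0 \<in> range triangle" by (metis rangeI triangle_0)
  then show ?thesis by (simp add: psi_def)
qed

lemma trisect_2_psi: "trisect 2 (psi c) = 0"
  using range_triangle_3(1) by (intro fps_ext) (simp add: psi_def)

text \<open>The surviving exponents are 9t + 1 with t triangular. Since 9t + 1 = 1 + 8t + t and c^2
  = 1, the coefficient c^(9t + 1) is c times the coefficient c^t of psi(cq).\<close>

lemma trisect_1_psi:
  assumes "c\<^sup>2 = 1"
  shows "trisect 1 (psi c) = fps_const c * (psi c oo fps_X ^ 3)"
proof (rule fps_ext)
  fix n
  have "c ^ (3 * n + 1) = c * c ^ (n div 3)" if dvd: "3 dvd n"
  proof -
    obtain k where k: "n = 3 * k" using dvd by blast
    have "3 * n + 1 = 1 + 2 * (4 * k) + k" using k by simp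
    then have "c ^ (3 * n + 1) = c * (c\<^sup>2) ^ (4 * k) * c ^ k"
      by (simp only: power_add power_mult power_one_right)
    then show ?thesis by (simp add: assms k)
  qed
  then show "trisect 1 (psi c) $ n = (fps_const c * (psi c oo fps_X ^ 3)) $ n"
    using range_triangle_3(2)[of n] by (auto simp: psi_def fps_nth_compose_X_cubed)
qed

text \<open>Shanks's finite form of Gauss's identity
  \<open>\<psi>(x) = (\<Prod>k\<ge>1. (1 - x ^ (2 * k)) / (1 - x ^ (2 * k - 1)))\<close>, with denominators cleared.
  The difference between consecutive right-hand sides telescopes.\<close>

lemma shanks_step:
  fixes x :: "'a :: comm_ring_1"
  defines "D \<equiv> \<lambda>n. \<Prod>k<n. 1 - x ^ (2 * k + 1)"
  defines "E \<equiv> \<lambda>m n. \<Prod>k\<in>{m..<n}. 1 - x ^ (2 * k + 2)"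
  assumes "m \<le> n"
  shows "(\<Sum>s\<le>m. E s (Suc n) * D s * x ^ (s * (2 * n + 3)))
       = (1 - x ^ (2 * n + 1)) * (\<Sum>s\<le>m. E s n * D s * x ^ (s * (2 * n + 1)))
         + E m n * D (Suc m) * x ^ ((m + 1) * (2 * n + 1))"
  using assms(3)
proof (induction m)
  case 0
  define p where "p = x ^ (2 * n + 1)"
  have "E 0 (Suc n) = E 0 n * (1 - x * p)" "D 0 = 1" "D (Suc 0) = 1 - x"
    "x ^ ((0 + 1) * (2 * n + 1)) = p"
    by (simp_all add: D_def E_def p_def)
  note eqs = this
  show ?case
    unfolding eqs p_def[symmetric] by (simp add: eqs(1,2) algebra_simps)
next
  case (Suc m)
  have 1: "E (Suc m) (Suc n) = E (Suc m) n * (1 - x ^ (2 * n + 2))"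
    using Suc.prems by (simp add: E_def)
  have 2: "E m n = (1 - x ^ (2 * m + 2)) * E (Suc m) n"
    using Suc.prems by (simp add: E_def prod.atLeast_Suc_lessThan)
  have 3: "D (Suc (Suc m)) = D (Suc m) * (1 - x ^ (2 * m + 3))"
    by (simp add: D_def numeral_3_eq_3)
  define y where "y = x ^ (Suc m * (2 * n + 1))"
  \<comment> \<open>The third equation, both sides being x^(2n + 2m + 4), is what lets the remainder
    pass from \<open>m\<close> to \<open>Suc m\<close>.\<close>
  have 4: "x ^ (Suc m * (2 * n + 3)) = y * x ^ (2 * m + 2)"
    "x ^ ((Suc m + 1) * (2 * n + 1)) = y * x ^ (2 * n + 1)"
    "x ^ (2 * n + 2) * x ^ (2 * m + 2) = x ^ (2 * n + 1) * x ^ (2 * m + 3)"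
    unfolding y_def power_add[symmetric]
    by (rule arg_cong[where f = "(^) x"], simp add: algebra_simps)+
  have 5: "x ^ ((m + 1) * (2 * n + 1)) = y" by (simp add: y_def)
  have IH: "(\<Sum>s\<le>m. E s (Suc n) * D s * x ^ (s * (2 * n + 3)))
       = (1 - x ^ (2 * n + 1)) * (\<Sum>s\<le>m. E s n * D s * x ^ (s * (2 * n + 1)))
         + E m n * D (Suc m) * x ^ ((m + 1) * (2 * n + 1))"
    using Suc by simp
  \<comment> \<open>The induction step as a ring identity, with p = x^(2n+1), w = x^(2n+2), q =
    x^(2m+2), r = x^(2m+3), and \<open>a\<close>, \<open>d\<close> for \<open>E (Suc m) n\<close>,
    \<open>D (Suc m)\<close>.\<close>
  have "((1 - p) * S + (1 - q) * a * d * y) + a * (1 - w) * d * (y * q)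
      = (1 - p) * (S + a * d * y) + a * (d * (1 - r)) * (y * p)"
    if "w * q = p * r" for S a d p q r w :: 'a
  proof -
    have "(1 - q) + (1 - w) * q = (1 - p) + (1 - r) * p"
      using that by (simp add: algebra_simps)
    then have "a * d * y * ((1 - q) + (1 - w) * q) = a * d * y * ((1 - p) + (1 - r) * p)"
      by (rule arg_cong)
    then show ?thesis by (simp add: algebra_simps)
  qed
  from this[OF 4(3)] show ?case
    unfolding sum.atMost_Suc IH 1 2 3 4(1,2) 5 y_def[symmetric] .
qed

lemma shanks:
  fixes x :: "'a :: comm_ring_1"
  shows "(\<Prod>k<n. 1 - x ^ (2 * k + 1)) * (\<Sum>s<2*n. x ^ triangle s)
       = (\<Sum>s<n. (\<Prod>k\<in>{s..<n}. 1 - x ^ (2 * k + 2)) * (\<Prod>k<s. 1 - x ^ (2 * k + 1)) * x ^ (s * (2 * n + 1)))"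
proof (induction n)
  case 0
  then show ?case by simp
next
  case (Suc n)
  \<comment> \<open>The two new triangular terms are matched by \<open>shanks_step\<close> at
    \<open>m = n\<close>: the summand \<open>s = n\<close> yields the first, the remainder the
    second.\<close>
  have t: "triangle (2 * n) = n * (2 * n + 1)" "triangle (2 * n + 1) = (n + 1) * (2 * n + 1)"
    using two_triangle[of "2 * n"] two_triangle[of "2 * n + 1"] by (simp_all add: algebra_simps)
  have "(\<Sum>s<2*Suc n. x ^ triangle s) = (\<Sum>s<2*n. x ^ triangle s) + x ^ triangle (2 * n) + x ^ triangle (2 * n + 1)"
    by simp
  note s = this[unfolded t]
  have "(\<Sum>s<Suc n. (\<Prod>k\<in>{s..<Suc n}. 1 - x ^ (2 * k + 2)) * (\<Prod>k<s. 1 - x ^ (2 * k + 1)) * x ^ (s * (2 * Suc n + 1)))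
    = (1 - x ^ (2 * n + 1)) * ((\<Sum>s<n. (\<Prod>k\<in>{s..<n}. 1 - x ^ (2 * k + 2)) * (\<Prod>k<s. 1 - x ^ (2 * k + 1)) * x ^ (s * (2 * n + 1)))
       + (\<Prod>k<n. 1 - x ^ (2 * k + 1)) * x ^ (n * (2 * n + 1)))
      + (\<Prod>k<Suc n. 1 - x ^ (2 * k + 1)) * x ^ ((n + 1) * (2 * n + 1))"
    (is "?L = _")
  proof -
    have "2 * Suc n + 1 = 2 * n + 3" by simp
    then have "?L = (1 - x ^ (2 * n + 1)) * (\<Sum>s\<le>n. (\<Prod>k\<in>{s..<n}. 1 - x ^ (2 * k + 2)) * (\<Prod>k<s. 1 - x ^ (2 * k + 1)) * x ^ (s * (2 * n + 1)))
         + (\<Prod>k<Suc n. 1 - x ^ (2 * k + 1)) * x ^ ((n + 1) * (2 * n + 1))"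
      unfolding lessThan_Suc_atMost[of n] using shanks_step[of n n x, OF order_refl]
      by (simp only: lessThan_Suc_atMost atLeastLessThan_empty order_refl prod.empty mult_1_left)
    then show ?thesis
      by (simp only: lessThan_Suc_atMost[symmetric] sum.lessThan_Suc atLeastLessThan_empty order_refl prod.empty mult_1_left)
  qed
  then show ?case
    unfolding s Suc.IH[symmetric] prod.lessThan_Suc
    by (simp only: distrib_left mult_ac)
qed

text \<open>Gauss's product modulo X^(2n+1), which avoids infinite products. To this precision only
  the term \<open>s = 0\<close> survives on the right of \<open>shanks\<close>, and its partial
  triangular sum agrees with psi.\<close>

lemma psi_gauss:
  fixes c :: int
  defines "x \<equiv> fps_const c * fps_X"
  shows "fps_X ^ (2 * n + 1) dvd (\<Prod>k<n. 1 - x ^ (2 * k + 1)) * psi c - (\<Prod>k<n. 1 - x ^ (2 * k + 2))"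
proof (cases "n = 0")
  \<comment> \<open>For \<open>n = 0\<close> the bound
    \<open>triangle (2 * n) \<ge> 2 * n + 1\<close> fails and the sum in \<open>shanks\<close> has
    no term \<open>s = 0\<close>.\<close>
  case True
  then show ?thesis by (simp add: fps_X_power_dvd_iff[of 1, simplified])
next
  case False
  define D where "D = (\<Prod>k<n. 1 - x ^ (2 * k + 1))"
  have xp: "x ^ k = fps_const (c ^ k) * fps_X ^ k" for k
    by (simp add: x_def power_mult_distrib)
  have inj: "inj triangle" using triangle_less by (metis injI less_irrefl nat_neq_iff)
  have 1: "fps_X ^ (2 * n + 1) dvd psi c - (\<Sum>s<2*n. x ^ triangle s)"
    unfolding fps_X_power_dvd_iff
  proof (intro allI impI)
    fix k assume k: "k < 2 * n + 1"
    have "triangle (2 * n) \<ge> 2 * n + 1"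
      using False two_triangle[of "2 * n"] by (cases n) (auto simp: algebra_simps)
    then have "k = triangle s \<Longrightarrow> s < 2 * n" for s
      using k triangle_less[of "2 * n" s] by (metis leD le_less_trans less_imp_le linorder_neqE_nat)
    then have "psi c $ k = (if k \<in> triangle ` {..<2 * n} then c ^ k else 0)"
      by (auto simp: psi_def)
    also have "\<dots> = (\<Sum>i\<in>triangle ` {..<2 * n}. if i = k then c ^ i else 0)"
      by simp
    also have "\<dots> = (\<Sum>s<2*n. x ^ triangle s) $ k"
      using inj by (subst sum.reindex) (auto simp: inj_on_def fps_sum_nth xp intro!: sum.cong)
    finally show "(psi c - (\<Sum>s<2*n. x ^ triangle s)) $ k = 0" by simp
  qed
  have "(\<Sum>s<n. (\<Prod>k\<in>{s..<n}. 1 - x ^ (2 * k + 2)) * (\<Prod>k<s. 1 - x ^ (2 * k + 1)) * x ^ (s * (2 * n + 1)))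
     = (\<Prod>k<n. 1 - x ^ (2 * k + 2)) + (\<Sum>s\<in>{1..<n}. (\<Prod>k\<in>{s..<n}. 1 - x ^ (2 * k + 2)) * (\<Prod>k<s. 1 - x ^ (2 * k + 1)) * x ^ (s * (2 * n + 1)))"
    (is "_ = _ + ?R")
    using False unfolding lessThan_atLeast0 by (subst sum.atLeast_Suc_lessThan) auto
  then have "D * (\<Sum>s<2*n. x ^ triangle s) = (\<Prod>k<n. 1 - x ^ (2 * k + 2)) + ?R"
    unfolding D_def shanks .
  then have eq: "D * psi c - (\<Prod>k<n. 1 - x ^ (2 * k + 2)) = D * (psi c - (\<Sum>s<2*n. x ^ triangle s)) + ?R"
    by (simp only: right_diff_distrib) simp
  have 2: "fps_X ^ (2 * n + 1) dvd ?R"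
  proof (intro dvd_sum dvd_mult)
    fix s assume "s \<in> {1..<n}"
    then have "1 * (2 * n + 1) \<le> s * (2 * n + 1)" by (intro mult_le_mono1) simp
    then have "2 * n + 1 \<le> s * (2 * n + 1)" by simp
    then show "fps_X ^ (2 * n + 1) dvd x ^ (s * (2 * n + 1))"
      unfolding xp by (intro dvd_mult le_imp_power_dvd)
  qed
  show ?thesis unfolding D_def[symmetric] eq by (intro dvd_add dvd_mult 1 2)
qed

subsection \<open>The generating function\<close>

definition pond_with_parts :: "nat set \<Rightarrow> nat \<Rightarrow> nat multiset set" where
  "pond_with_parts S w = {M. set_mset M \<subseteq> S \<and> is_pond_partition M w}"

definition pond_gf :: "nat set \<Rightarrow> int fps" where
  "pond_gf S = Abs_fps (\<lambda>w. int (card (pond_with_parts S w)))"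

text \<open>The exponent \<open>i\<close> is the total weight of all copies of \<open>m\<close>, so
  \<open>i = m\<close> is the single copy forbidden for odd \<open>m\<close>.\<close>

definition part_gf :: "nat \<Rightarrow> int fps" where
  "part_gf m = Abs_fps (\<lambda>i. if m dvd i \<and> \<not> (odd m \<and> i = m) then 1 else 0)"

lemma finite_pond_with_parts: "finite (pond_with_parts S w)"
  by (rule finite_subset[OF _ finite_pond_partitions[of w]]) (auto simp: pond_with_parts_def)

text \<open>Sorting by the total weight \<open>i\<close> of the copies of \<open>m\<close> makes the
  count a convolution, as in a product of power series.\<close>

lemma pond_with_parts_insert:
  assumes "m \<notin> S" "m > 0"
  shows "pond_with_parts (insert m S) w =
    (\<Union>i\<in>{i\<in>{0..w}. m dvd i \<and> \<not> (odd m \<and> i = m)}. (\<lambda>N. N + replicate_mset (i div m) m) ` pond_with_parts S (w - i))"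
    (is "_ = (\<Union>i\<in>?I. ?f i ` _)")
proof (intro subset_antisym subsetI)
  fix M assume M: "M \<in> pond_with_parts (insert m S) w"
  define N where "N = filter_mset (\<lambda>x. x \<noteq> m) M"
  define i where "i = count M m * m"
  have i: "i div m = count M m" using assms by (simp add: i_def)
  have MN: "M = N + replicate_mset (count M m) m"
    by (rule multiset_eqI) (auto simp: N_def)
  have w: "sum_mset M = w" using M by (simp add: pond_with_parts_def is_pond_partition_def is_partition_def)
  have "sum_mset M = sum_mset N + i" by (subst MN) (simp add: i_def)
  with w have iw: "sum_mset N = w - i" "i \<le> w" by auto
  have "\<not> (odd m \<and> count M m = 1)"
    using M by (auto simp: pond_with_parts_def is_pond_partition_def)
      (metis One_nat_def count_eq_zero_iff zero_neq_one)
  then have "i \<in> ?I" using iw assms by (auto simp: i_def)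
  moreover have "N \<in> pond_with_parts S (w - i)"
    using M iw by (auto simp: pond_with_parts_def is_pond_partition_def is_partition_def N_def)
  ultimately show "M \<in> (\<Union>i\<in>?I. ?f i ` pond_with_parts S (w - i))"
    using MN i by auto
next
  fix M assume "M \<in> (\<Union>i\<in>?I. ?f i ` pond_with_parts S (w - i))"
  then obtain i N where i: "i \<le> w" "m dvd i" "\<not> (odd m \<and> i = m)" and N: "N \<in> pond_with_parts S (w - i)"
    and M: "M = ?f i N" by auto
  obtain j where j: "i = m * j" using i by blast
  then have M: "M = N + replicate_mset j m" using M assms by simp
  have "count N m = 0" using N assms by (auto simp: pond_with_parts_def count_eq_zero_iff)
  then show "M \<in> pond_with_parts (insert m S) w"
    using N i assms unfolding M j
    by (auto simp: pond_with_parts_def is_pond_partition_def is_partition_def mult.commute split: if_splits)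
qed

lemma pond_gf_insert:
  assumes "m \<notin> S" "m > 0"
  shows "pond_gf (insert m S) = part_gf m * pond_gf S"
proof (rule fps_ext)
  fix w
  let ?I = "{i\<in>{0..w}. m dvd i \<and> \<not> (odd m \<and> i = m)}"
  let ?A = "\<lambda>i. (\<lambda>N. N + replicate_mset (i div m) m) ` pond_with_parts S (w - i)"
  have count: "count M m = i div m" if "M \<in> ?A i" for M i
    using that assms by (auto simp: pond_with_parts_def count_eq_zero_iff)
  have disjoint: "?A i \<inter> ?A j = {}" if "i \<in> ?I" "j \<in> ?I" "i \<noteq> j" for i j
  proof -
    have "i div m \<noteq> j div m" using that by (auto simp: dvd_div_eq_iff)
    then show ?thesis using count[of _ i] count[of _ j] by (metis disjoint_iff)
  qed
  have "card (pond_with_parts (insert m S) w) = (\<Sum>i\<in>?I. card (?A i))"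
    unfolding pond_with_parts_insert[OF assms]
  proof (rule card_UN_disjoint)
    show "\<forall>i\<in>?I. \<forall>j\<in>?I. i \<noteq> j \<longrightarrow> ?A i \<inter> ?A j = {}" using disjoint by blast
  qed (simp_all add: finite_pond_with_parts)
  also have "\<dots> = (\<Sum>i\<in>?I. card (pond_with_parts S (w - i)))"
    by (intro sum.cong card_image) (auto simp: inj_on_def)
  finally have "pond_gf (insert m S) $ w = (\<Sum>i\<in>?I. int (card (pond_with_parts S (w - i))))"
    by (simp add: pond_gf_def)
  also have "\<dots> = (\<Sum>i=0..w. if m dvd i \<and> \<not> (odd m \<and> i = m) then int (card (pond_with_parts S (w - i))) else 0)"
    by (subst sum.inter_filter) auto
  also have "\<dots> = (part_gf m * pond_gf S) $ w"
    unfolding fps_mult_nth by (intro sum.cong) (auto simp: part_gf_def pond_gf_def)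
  finally show "pond_gf (insert m S) $ w = (part_gf m * pond_gf S) $ w" .
qed

lemma part_gf_even:
  assumes "even m" "m > 0"
  shows "part_gf m * (1 - fps_X ^ m) = 1"
proof (rule fps_ext)
  fix n
  have "n = 0 \<or> n < m \<and> \<not> m dvd n \<or> (\<exists>k. n = k + m)"
    using assms nat_dvd_not_less by (metis add.commute le_Suc_ex not_gr_zero not_less)
  then show "(part_gf m * (1 - fps_X ^ m)) $ n = 1 $ n"
    using assms by (auto simp: part_gf_def right_diff_distrib fps_X_power_mult_right_nth)
qed

text \<open>With y = X^m this is 1/(1-y) - y = (1 - y + y^2)/(1-y) = (1 + y^3)/(1 - y^2). On
  coefficients: those at k and k + 2m differ only for k = m, which leaves X^(3m).\<close>

lemma part_gf_odd:
  assumes "odd m"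
  shows "part_gf m * (1 - fps_X ^ (2 * m)) = 1 + fps_X ^ (3 * m)"
proof (rule fps_ext)
  fix n
  have m: "m > 0" using assms by (cases m) auto
  have "n = 0 \<or> n = m \<or> n < 2 * m \<and> n \<noteq> m \<and> n \<noteq> 0 \<and> \<not> m dvd n \<or> (\<exists>k. n = k + 2 * m)"
  proof (cases "n < 2 * m")
    case True
    have "n = 0 \<or> n = m" if dvd: "m dvd n"
    proof -
      obtain k where "n = k * m" using dvd by (metis dvd_def mult.commute)
      moreover from this have "k < 2" using True by (simp only: mult_less_cancel2)
      ultimately show ?thesis by (auto simp: less_2_cases_iff)
    qed
    with True show ?thesis by blast
  next
    case False
    then show ?thesis by (metis add.commute le_Suc_ex not_less)
  qed
  moreover have "m dvd k + 2 * m \<longleftrightarrow> m dvd k" for k by (simp add: dvd_add_left_iff)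
  ultimately show "(part_gf m * (1 - fps_X ^ (2 * m))) $ n = (1 + fps_X ^ (3 * m)) $ n"
    using assms m by (auto simp: part_gf_def right_diff_distrib fps_X_power_mult_right_nth)
qed

lemma pond_gf_empty: "pond_gf {} = 1"
proof (rule fps_ext)
  fix w
  have "pond_with_parts {} w = (if w = 0 then {{#}} else {})"
    by (auto simp: pond_with_parts_def is_pond_partition_def is_partition_def)
  then show "pond_gf {} $ w = 1 $ w" by (simp add: pond_gf_def)
qed

text \<open>Parts up to \<open>2 * n\<close> comprise \<open>n\<close> even and \<open>n\<close> odd
  sizes, matching the products in \<open>psi_gauss\<close>; coefficients up to \<open>2 * n\<close>
  are then those of \<open>pond\<close>.\<close>

lemma pond_gf_product:
  "pond_gf {0<..2*n} * (\<Prod>k<n. 1 - fps_X ^ (2 * k + 2)) * (\<Prod>k<n. 1 - fps_X ^ (2 * (2 * k + 1)))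
    = (\<Prod>k<n. 1 + fps_X ^ (3 * (2 * k + 1)))"
proof (induction n)
  case 0
  then show ?case by (simp add: pond_gf_empty)
next
  case (Suc n)
  have "{0<..2*Suc n} = insert (2 * n + 2) (insert (2 * n + 1) {0<..2*n})" by auto
  then have insert: "pond_gf {0<..2*Suc n} = part_gf (2 * n + 2) * (part_gf (2 * n + 1) * pond_gf {0<..2*n})"
    by (simp add: pond_gf_insert)
  have even: "part_gf (2 * n + 2) * (1 - fps_X ^ (2 * n + 2)) = 1"
    by (rule part_gf_even) auto
  have odd: "part_gf (2 * n + 1) * (1 - fps_X ^ (2 * (2 * n + 1))) = 1 + fps_X ^ (3 * (2 * n + 1))"
    by (rule part_gf_odd) auto
  have "(g2 * (g1 * G)) * (A * a) * (B * b) = C * (1 + c)"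
    if "g2 * a = 1" "g1 * b = 1 + c" "G * A * B = C" for g1 g2 G A a B b C c :: "int fps"
  proof -
    have "(g2 * (g1 * G)) * (A * a) * (B * b) = (g2 * a) * (G * A * B) * (g1 * b)"
      by (simp only: mult_ac)
    then show ?thesis by (simp add: that)
  qed
  from this[OF even odd Suc.IH] show ?case
    unfolding insert prod.lessThan_Suc .
qed

lemma pond_eq_pond_gf_nth:
  assumes "w \<le> 2 * n"
  shows "int (pond w) = pond_gf {0<..2*n} $ w"
proof -
  have "set_mset M \<subseteq> {0<..2*n}" if "is_pond_partition M w" for M
  proof
    fix k assume k: "k \<in># M"
    then have "k \<le> sum_mset M" using sum_mset.remove[OF k] by simp
    then show "k \<in> {0<..2*n}"
      using k that assms by (auto simp: is_pond_partition_def is_partition_def)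
  qed
  then have "{M. is_pond_partition M w} = pond_with_parts {0<..2*n} w"
    by (auto simp: pond_with_parts_def)
  then show ?thesis by (simp add: pond_def pond_gf_def)
qed

text \<open>For coefficient \<open>n\<close> it suffices to work modulo 3 and X^(2n+1). There D
  psi(q) = E, D' psi(-q) = E and G E D D' = D'^3, so G psi(-q)^2 = D'^2/(E D) * E^2/D'^2 = E/D =
  psi(q).\<close>

lemma pond_psi:
  "3 dvd Abs_fps (\<lambda>w. int (pond w)) * (psi (-1))\<^sup>2 - psi 1" (is "3 dvd ?P * _ - _")
  unfolding three_dvd_fps_iff
proof
  fix n
  define X :: "int fps" where "X = fps_X"
  define D D' E G where "D = (\<Prod>k<n. 1 - X ^ (2 * k + 1))" and "D' = (\<Prod>k<n. 1 + X ^ (2 * k + 1))"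
    and "E = (\<Prod>k<n. 1 - X ^ (2 * k + 2))" and "G = pond_gf {0<..2*n}"
  have "fps_X ^ (2 * n + 1) dvd D * psi 1 - E"
    using psi_gauss[of n 1] by (simp add: D_def E_def X_def)
  then obtain a where a: "D * psi 1 - E = X ^ (2 * n + 1) * a" unfolding X_def by blast
  have powers: "(fps_const (-1 :: int) * fps_X) ^ k = (if even k then fps_X ^ k else - (fps_X ^ k))" for k
    by (simp add: power_minus' flip: fps_const_neg)
  then have "fps_X ^ (2 * n + 1) dvd D' * psi (-1) - E"
    using psi_gauss[of n "-1", unfolded powers] by (simp add: D'_def E_def X_def)
  then obtain b where b: "D' * psi (-1) - E = X ^ (2 * n + 1) * b" unfolding X_def by blast
  have DD': "(\<Prod>k<n. 1 - X ^ (2 * (2 * k + 1))) = D * D'"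
    unfolding D_def D'_def prod.distrib[symmetric]
    by (intro prod.cong refl) (simp add: algebra_simps flip: power_add mult_2)
  \<comment> \<open>Factor by factor, 1 + y^3 = (1 + y)^3 modulo 3.\<close>
  have "3 dvd (\<Prod>k<n. 1 + X ^ (3 * (2 * k + 1))) - D' ^ 3"
    unfolding D'_def
  proof (induction n)
    case (Suc n)
    define y where "y = X ^ (2 * n + 1)"
    have "X ^ (3 * (2 * n + 1)) = y ^ 3" unfolding y_def by (simp only: power_mult[symmetric] mult.commute)
    moreover obtain u where "(\<Prod>k<n. 1 + X ^ (3 * (2 * k + 1))) - (\<Prod>k<n. 1 + X ^ (2 * k + 1)) ^ 3 = 3 * u"
      using Suc by blast
    moreover have "Q * (1 + z) - (R * (1 + y)) ^ 3 = 3 * (u * (1 + y ^ 3) - R ^ 3 * (y + y\<^sup>2))"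
      if "z = y ^ 3" "Q - R ^ 3 = 3 * u" for Q R z u :: "int fps"
    proof -
      have "Q = R ^ 3 + 3 * u" using that(2) by (simp add: algebra_simps)
      then show ?thesis using that(1) by (simp add: power3_eq_cube power2_eq_square algebra_simps)
    qed
    ultimately have "(\<Prod>k<Suc n. 1 + X ^ (3 * (2 * k + 1))) - (\<Prod>k<Suc n. 1 + X ^ (2 * k + 1)) ^ 3
      = 3 * (u * (1 + y ^ 3) - (\<Prod>k<n. 1 + X ^ (2 * k + 1)) ^ 3 * (y + y\<^sup>2))"
      unfolding prod.lessThan_Suc y_def[symmetric] by blast
    then show ?case by simp
  qed simp
  then obtain u where u: "(\<Prod>k<n. 1 + X ^ (3 * (2 * k + 1))) - D' ^ 3 = 3 * u" by blast
  have "fps_X ^ (2 * n + 1) dvd ?P - G"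
    unfolding fps_X_power_dvd_iff G_def by (simp add: pond_eq_pond_gf_nth)
  then obtain v where v: "?P - G = X ^ (2 * n + 1) * v" unfolding X_def by blast
  have G: "G * E * (D * D') = D' ^ 3 + 3 * u"
    using u unfolding pond_gf_product[of n, folded X_def, folded G_def E_def, unfolded DD', symmetric]
    by (simp only: diff_eq_eq add.commute)
  define p p' where "p = psi 1" and "p' = psi (-1)"
  \<comment> \<open>After multiplication by D D'^2, every truncation error is a multiple of
    \<open>M\<close>; \<open>r\<close> collects the cofactors.\<close>
  define M r where "M = X ^ (2 * n + 1)" and "r = D * D' * D' * v * p'\<^sup>2 + G * D * D' * p' * b + D'\<^sup>2 * (b - a)"
  have eqs: "D * p = E + M * a" "D' * p' = E + M * b" "?P = G + M * v"
    using a b v unfolding M_def p_def p'_def by (simp_all add: algebra_simps)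
  have "(D * D' * D') * (?P * p'\<^sup>2 - p) = M * (D * D' * D' * v * p'\<^sup>2) + G * D * D' * p' * (D' * p') - D'\<^sup>2 * (D * p)"
    unfolding eqs(3) by (simp add: power2_eq_square algebra_simps)
  also have "\<dots> = M * (D * D' * D' * v * p'\<^sup>2) + (G * E * (D * D')) * p' + M * (G * D * D' * p' * b) - D'\<^sup>2 * (D * p)"
    unfolding eqs(2) by (simp add: algebra_simps)
  also have "\<dots> = M * (D * D' * D' * v * p'\<^sup>2) + D'\<^sup>2 * (D' * p') + 3 * (u * p') + M * (G * D * D' * p' * b) - D'\<^sup>2 * (D * p)"
    unfolding G by (simp add: power2_eq_square power3_eq_cube algebra_simps)
  also have "\<dots> = 3 * (u * p') + M * r"
    unfolding eqs(1,2) r_def by (simp add: algebra_simps)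
  finally have "(D * D' * D') * (?P * p'\<^sup>2 - p) = 3 * (u * p') + M * r" .
  moreover have "(D * D' * D') $ 0 = 1"
  proof -
    have "D $ 0 = 1" "D' $ 0 = 1"
      unfolding D_def D'_def X_def by (induction n) auto
    then show ?thesis by simp
  qed
  then obtain V where "V * (D * D' * D') = 1"
    using fps_left_inverse[of 1 "D * D' * D'"] by auto
  ultimately have "?P * p'\<^sup>2 - p = V * (3 * (u * p') + M * r)"
    by (metis mult.assoc mult_1_left)
  then have "?P * p'\<^sup>2 - p = 3 * (V * u * p') + M * (V * r)"
    by (simp add: algebra_simps)
  \<comment> \<open>The index \<open>n\<close> lies below the order \<open>2 * n + 1\<close> of
    \<open>M\<close>.\<close>
  moreover have "(M * (V * r)) $ n = 0"
    by (simp only: M_def X_def fps_X_power_mult_nth) simp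
  ultimately have "3 dvd (?P * p'\<^sup>2 - p) $ n" by simp
  then show "3 dvd (?P * (psi (-1))\<^sup>2 - psi 1) $ n" unfolding p_def p'_def .
qed

theorem theorem3:
  fixes n :: nat
  shows "[pond (27 * n + 17) = pond (3 * n + 2)] (mod 3)"
proof -
  define P where "P = Abs_fps (\<lambda>w. int (pond w))"
  \<comment> \<open>In terms of the series variable X, these are psi(X), psi(-X), psi(X^3) and
    psi(-X^3); \<open>q\<close> is not the variable.\<close>
  define p q p3 q3 where "p = psi 1" and "q = psi (-1)"
    and "p3 = p oo fps_X ^ 3" and "q3 = q oo fps_X ^ 3"
  obtain u where u: "P * q\<^sup>2 - p = 3 * u" using pond_psi unfolding P_def p_def q_def by blast
  obtain v where v: "q ^ 3 - q3 = 3 * v" using three_dvd_fps_cube_diff unfolding q3_def by blast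
  have tp: "trisect 1 p = p3" "trisect 1 q = - q3" "trisect 2 p = 0" "trisect 2 q = 0"
    unfolding p_def q_def p3_def q3_def
    by (simp_all add: trisect_1_psi trisect_2_psi del: One_nat_def flip: fps_const_neg)
  \<comment> \<open>Multiplying by \<open>q\<close> turns q^2 into q^3, which modulo 3 is a series
    in X^3 and so passes through \<open>trisect\<close>.\<close>
  have "P * q3 = p * q + 3 * (u * q - P * v)" using u v by algebra
  then have "trisect 2 (P * q3) = trisect 2 (p * q) + 3 * trisect 2 (u * q - P * v)"
    by (simp only: trisect_linear)
  then have "trisect 2 P * q = - p3 * q3 + 3 * trisect 2 (u * q - P * v)"
    unfolding q3_def by (simp add: trisect_mult_compose trisect_2_mult tp q3_def del: One_nat_def)
  \<comment> \<open>Replacing \<open>q3\<close> by q^3 modulo 3 once more exposes a common factor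
    \<open>q\<close>, cancellable because its constant term is 1.\<close>
  then have "q * (trisect 2 P + p3 * q\<^sup>2) = 3 * (p3 * v + trisect 2 (u * q - P * v))"
    using v by algebra
  then have "3 dvd q * (trisect 2 P + p3 * q\<^sup>2)" by simp
  then have "3 dvd trisect 2 P + p3 * q\<^sup>2"
    by (rule fps_dvd_mult_unit_cancel) (simp add: q_def)
  then obtain z where "trisect 2 P + p3 * q\<^sup>2 = 3 * z" by blast
  then have z: "trisect 2 P = - (q\<^sup>2 * p3) + 3 * z" by algebra
  have "trisect 2 (q\<^sup>2) = q3\<^sup>2"
    by (simp add: power2_eq_square trisect_2_mult tp del: One_nat_def)
  also have "q3\<^sup>2 = q\<^sup>2 oo fps_X ^ 3"
    unfolding q3_def power2_eq_square by (rule fps_compose_mult_distrib[symmetric]) simp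
  finally have q2: "trisect 2 (q\<^sup>2) = q\<^sup>2 oo fps_X ^ 3" .
  \<comment> \<open>The factors swap roles: the first selection turns \<open>p3\<close> into
    \<open>p\<close> and q^2 into a series in X^3; the second turns these back into
    \<open>p3\<close> and q^2.\<close>
  have "trisect 1 (trisect 2 (q\<^sup>2 * p3)) = trisect 1 (p * (q\<^sup>2 oo fps_X ^ 3))"
    unfolding p3_def trisect_mult_compose[of 2, simplified] q2 by (simp only: mult.commute)
  also have "\<dots> = q\<^sup>2 * p3" by (simp add: trisect_mult_compose tp del: One_nat_def)
  finally have "trisect 1 (trisect 2 (trisect 2 P)) = - (q\<^sup>2 * p3) + 3 * trisect 1 (trisect 2 z)"
    by (simp only: z trisect_linear)
  then have "trisect 1 (trisect 2 (trisect 2 P)) - trisect 2 P = 3 * (trisect 1 (trisect 2 z) - z)"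
    unfolding z by (simp add: algebra_simps)
  then have "3 dvd (trisect 1 (trisect 2 (trisect 2 P)) - trisect 2 P) $ n" by simp
  \<comment> \<open>The nested selections read off the index 3(3(3n + 1) + 2) + 2 = 27n +
    17.\<close>
  then have "3 dvd int (pond (27 * n + 17)) - int (pond (3 * n + 2))"
    by (simp add: P_def algebra_simps)
  then have "[int (pond (27 * n + 17)) = int (pond (3 * n + 2))] (mod int 3)"
    by (simp add: cong_iff_dvd_diff)
  then show ?thesis by (simp only: cong_int_iff)
qed

end
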